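(* Let $A_2=e^{z}\frac{d}{dz}$. For $k=1,2,3,\dots$ the following representation is valid: $$A_2^{k}=e^{kz}\sum_{s=1}^{k}(-1)^{k-s}S(k,s)\Big(\frac{d}{dz}\Big)^{s}.$$
   Context: $S(k,s)$ are the (signed) Stirling numbers of the first kind, defined by $x(x-1)\cdots(x-k+1)=\sum_{s=0}^{k}S(k,s)x^{s}$. $A_2^{k}$ is the $k$-fold composition; operators act on entire and meromorphic functions on $\mathbb{C}$. *)

theory Defs
  imports "HOL-Complex_Analysis.Complex_Analysis" "HOL-Computational_Algebra.Polynomial"
begin

text \<open>The coefficient of $x^s$ in $x(x-1)\cdots(x-k+1)$. The constant \<open>stirling\<close> of
  \<open>HOL-Combinatorics\<close> is the unsigned version.\<close>

definition signed_stirling1 :: "nat \<Rightarrow> nat \<Rightarrow> int" where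
  "signed_stirling1 k s = coeff (\<Prod>i<k. [:- int i, 1:]) s"

definition A2 :: "(complex \<Rightarrow> complex) \<Rightarrow> complex \<Rightarrow> complex" where
  "A2 f = (\<lambda>z. exp z * deriv f z)"

text \<open>A meromorphic function is represented by a total function whose values at its isolated
  singularities carry no meaning (and \<open>deriv\<close> is unspecified there). Hence identities between
  meromorphic functions are to be stated at the points where the function is analytic; these form
  a cosparse set by \<open>meromorphic_on_imp_analytic_cosparse\<close>.\<close>

end

theory Submission
  imports Defs "HOL-Combinatorics.Stirling"
begin

text \<open>The numbers $(-1)^{k-s}S(k,s)$ are the unsigned Stirling numbers $c(k,s)$. Since
  $e^z\frac{d}{dz}(e^{kz}g) = e^{(k+1)z}(kg + g')$, applying $A_2$ once more turns the coefficients
  $c(k,s)$ into $k\,c(k,s) + c(k,s-1) = c(k+1,s)$.\<close>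

text \<open>Multiplying the product by the new factor \<open>x - k\<close> gives S(k+1,s) = S(k,s-1)
  - k S(k,s), which is the recurrence of \<open>stirling\<close> up to signs. The exponent
  \<open>k + s\<close> has the parity of \<open>k - s\<close> for \<open>s \<le> k\<close> and
  avoids truncated subtraction.\<close>

lemma signed_stirling1_eq_stirling:
  "signed_stirling1 k s = (-1) ^ (k + s) * int (stirling k s)"
proof (induction k arbitrary: s)
  case 0
  then show ?case by (cases s) (auto simp: signed_stirling1_def)
next
  case (Suc k)
  have rec: "signed_stirling1 (Suc k) s =
      (case s of 0 \<Rightarrow> 0 | Suc t \<Rightarrow> signed_stirling1 k t) - int k * signed_stirling1 k s"
    by (simp add: signed_stirling1_def coeff_pCons mult.commute[of _ "[:- int k, 1:]"] split: nat.split)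
  show ?case
  proof (cases s)
    case 0
    \<comment> \<open>The remaining term \<open>int k * signed_stirling1 k 0\<close> vanishes:
      either \<open>k = 0\<close>, or \<open>stirling k 0 = 0\<close>.\<close>
    then show ?thesis using rec Suc.IH[of 0] by (cases k) simp_all
  next
    case (Suc t)
    then show ?thesis using rec by (simp add: Suc.IH algebra_simps)
  qed
qed

text \<open>Quantifying over all points of an open set makes the induction hypothesis an identity
  near \<open>z\<close>, so it can be differentiated. Starting the sum at \<open>s = 0\<close> lets
  the induction begin at \<open>k = 0\<close>, where the operator is the identity.\<close>

lemma funpow_A2_eq_stirling_sum:
  fixes f :: "complex \<Rightarrow> complex"
  assumes "open U" "f holomorphic_on U" "z \<in> U"
  shows "(A2 ^^ k) f z =
    exp (of_nat k * z) * (\<Sum>s\<le>k. of_nat (stirling k s) * (deriv ^^ s) f z)"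
  using \<open>z \<in> U\<close>
proof (induction k arbitrary: z)
  case 0
  then show ?case by simp
next
  case (Suc k)
  define F where
    "F = (\<lambda>w. exp (of_nat k * w) * (\<Sum>s\<le>k. of_nat (stirling k s) * (deriv ^^ s) f w))"
  define a where "a = (\<lambda>s. of_nat (stirling k s) * (deriv ^^ s) f z)"
  define b where "b = (\<lambda>s. of_nat (stirling k s) * (deriv ^^ Suc s) f z)"
  have deriv_F: "(F has_field_derivative
      exp (of_nat k * z) * (of_nat k * (\<Sum>s\<le>k. a s) + (\<Sum>s\<le>k. b s))) (at z)"
  proof -
    have "((deriv ^^ s) f has_field_derivative (deriv ^^ Suc s) f z) (at z)" for s
      using holomorphic_derivI[OF holomorphic_higher_deriv[OF assms(2,1)] assms(1) Suc.prems] by simp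
    then have "((\<lambda>w. \<Sum>s\<le>k. of_nat (stirling k s) * (deriv ^^ s) f w) has_field_derivative
        (\<Sum>s\<le>k. b s)) (at z)"
      unfolding b_def by (intro DERIV_sum DERIV_cmult)
    moreover have "((\<lambda>w. exp (of_nat k * w)) has_field_derivative of_nat k * exp (of_nat k * z)) (at z)"
      by (auto intro!: derivative_eq_intros)
    ultimately show ?thesis
      unfolding F_def a_def by (auto dest: DERIV_mult simp: algebra_simps)
  qed
  have "eventually (\<lambda>w. (A2 ^^ k) f w = F w) (nhds z)"
    using eventually_nhds_in_open[OF assms(1) Suc.prems]
    by eventually_elim (simp add: F_def Suc.IH)
  then have "deriv ((A2 ^^ k) f) z = deriv F z"
    by (intro deriv_cong_ev refl)
  then have "(A2 ^^ Suc k) f z = exp (of_nat (Suc k) * z) * (of_nat k * (\<Sum>s\<le>k. a s) + (\<Sum>s\<le>k. b s))"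
    using DERIV_imp_deriv[OF deriv_F] by (simp add: A2_def exp_add distrib_right)
  \<comment> \<open>The added top term is zero because
    \<open>stirling k (Suc k) = 0\<close>.\<close>
  also have "of_nat k * (\<Sum>s\<le>k. a s) = of_nat k * (\<Sum>s\<le>Suc k. a s)"
    by (simp add: a_def)
  \<comment> \<open>Dropping the term \<open>a 0\<close> is harmless: for \<open>k = 0\<close> the
    outer factor is zero, and otherwise \<open>stirling k 0 = 0\<close>. Now
    \<open>a (Suc s)\<close> and \<open>b s\<close> involve the same derivative of
    \<open>f\<close>.\<close>
  also have "\<dots> = of_nat k * (\<Sum>s\<le>k. a (Suc s))"
    by (cases k) (simp_all add: a_def sum.atMost_Suc_shift del: sum.atMost_Suc)
  also have "\<dots> + (\<Sum>s\<le>k. b s) =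
      (\<Sum>s\<le>k. of_nat (stirling (Suc k) (Suc s)) * (deriv ^^ Suc s) f z)"
    by (simp add: a_def b_def sum_distrib_left sum.distrib algebra_simps)
  \<comment> \<open>The index \<open>s = 0\<close> returns at no cost, since
    \<open>stirling (Suc k) 0 = 0\<close>.\<close>
  also have "\<dots> = (\<Sum>s\<le>Suc k. of_nat (stirling (Suc k) s) * (deriv ^^ s) f z)"
    by (simp add: sum.atMost_Suc_shift del: sum.atMost_Suc stirling.simps(4) funpow.simps)
  finally show ?case .
qed

lemma funpow_A2_eq_signed_stirling1_sum:
  fixes f :: "complex \<Rightarrow> complex"
  assumes "k \<ge> 1" "f analytic_on {z}"
  shows "(A2 ^^ k) f z = exp (of_nat k * z) *
    (\<Sum>s=1..k. (-1) ^ (k - s) * of_int (signed_stirling1 k s) * (deriv ^^ s) f z)"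
proof -
  obtain U where U: "open U" "z \<in> U" "f holomorphic_on U"
    using assms(2) by (auto simp: analytic_at)
  have "(\<Sum>s\<le>k. of_nat (stirling k s) * (deriv ^^ s) f z) =
      (\<Sum>s=1..k. of_nat (stirling k s) * (deriv ^^ s) f z)"
  proof (rule sum.mono_neutral_right)
    \<comment> \<open>Only \<open>s = 0\<close> is left out; its coefficient is zero because
      \<open>k \<ge> 1\<close>.\<close>
    show "\<forall>s\<in>{..k} - {1..k}. of_nat (stirling k s) * (deriv ^^ s) f z = 0"
      using assms(1) by (cases k) (auto simp: not_le)
  qed auto
  also have "\<dots> = (\<Sum>s=1..k. (-1) ^ (k - s) * of_int (signed_stirling1 k s) * (deriv ^^ s) f z)"
  proof (rule sum.cong)
    fix s assume "s \<in> {1..k}"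
    \<comment> \<open>As \<open>s \<le> k\<close>, the subtraction is exact and the sum equals
      \<open>2 * k\<close>, so the two signs cancel.\<close>
    then have "even ((k - s) + (k + s))" by simp
    then have "(-1) ^ (k - s) * (-1) ^ (k + s) = (1 :: complex)"
      by (simp only: power_add[symmetric] neg_one_even_power)
    then show "of_nat (stirling k s) * (deriv ^^ s) f z =
        (-1) ^ (k - s) * of_int (signed_stirling1 k s) * (deriv ^^ s) f z"
      by (simp add: signed_stirling1_eq_stirling flip: mult.assoc)
  qed simp
  finally show ?thesis
    using funpow_A2_eq_stirling_sum[OF U(1,3,2)] by simp
qed

theorem theorem5p1:
  fixes k :: nat
  assumes "k \<ge> 1"
  shows "(\<forall>f :: complex \<Rightarrow> complex. f holomorphic_on UNIV \<longrightarrow>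
           (A2 ^^ k) f =
             (\<lambda>z. exp (of_nat k * z) *
                (\<Sum>s=1..k. (-1) ^ (k - s) * of_int (signed_stirling1 k s) * (deriv ^^ s) f z))) \<and>
         (\<forall>f :: complex \<Rightarrow> complex. f meromorphic_on UNIV \<longrightarrow>
           (\<forall>z. f analytic_on {z} \<longrightarrow>
             (A2 ^^ k) f z =
               exp (of_nat k * z) *
                 (\<Sum>s=1..k. (-1) ^ (k - s) * of_int (signed_stirling1 k s) * (deriv ^^ s) f z)))"
  \<comment> \<open>Both halves follow pointwise, an entire function being analytic at every
    point.\<close>
  using funpow_A2_eq_signed_stirling1_sum[OF assms]
  by (auto intro!: ext simp: analytic_on_open[of UNIV, symmetric] intro: analytic_on_subset)

end
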